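(* Let $(b_1,b_2,b_3)$ be a basis of $\mathbb{R}^3$, let $\Lambda=\mathbb{Z}b_1+\mathbb{Z}b_2+\mathbb{Z}b_3$, set $b_0=-b_1-b_2-b_3$, and suppose that the Selling parameters $\rho_{ij}=-\langle b_i,b_j\rangle$ are non-negative for all $0\le i<j\le 3$. Write $a=\rho_{01}$, $b=\rho_{02}$, $c=\rho_{03}$, $d=\rho_{12}$, $e=\rho_{13}$, $f=\rho_{23}$, and let $A=(\langle b_i,b_j\rangle)_{1\le i,j\le 3}$ be the Gram matrix. Let $A_T$ be the surface area of the Voronoi cell of $\Lambda$, and let $F=A_T/(\det A)^{1/3}$. Then $$ \begin{aligned} F=\frac{2}{(\det A)^{5/6}}\Big(& a f \sqrt{b+c+d+e} + b e \sqrt{a+c+d+f} + c d \sqrt{a+b+e+f} \\ &+ \sqrt{a+b+c}\,(de+df+ef) + \sqrt{a+d+e}\,(bc+bf+cf) \\ &+ \sqrt{b+d+f}\,(ac+ae+ce) + \sqrt{c+e+f}\,(ab+ad+bd)\Big), \end{aligned} $$ where $$ \begin{aligned} \det A={}&abc+abe+abf+acd+acf+ade+adf+aef\\ &+bcd+bce+bde+bdf+bef+cde+cdf+cef. \end{aligned} $$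
   Context: The Voronoi cell of a lattice $\Lambda\subset\mathbb{R}^3$ is $\{x\in\mathbb{R}^3:\ \|x\|\le\|x-v\|\ \text{for all } v\in\Lambda\}$, a convex polytope of volume $\sqrt{\det A}$, where $A$ is the Gram matrix of any basis of $\Lambda$. Its surface area is the sum of the areas of its two-dimensional faces. Thus $F$ is the scale-invariant isoperimetric quotient (surface area)/(volume)$^{2/3}$ of the Voronoi cell. *)

theory Defs
  imports "HOL-Analysis.Analysis"
begin

definition is_basis3 :: "(nat \<Rightarrow> real^3) \<Rightarrow> bool" where
  "is_basis3 b \<longleftrightarrow>
     inj_on b {1..3} \<and> independent (b ` {1..3}) \<and> span (b ` {1..3}) = UNIV"

definition lattice3 :: "(nat \<Rightarrow> real^3) \<Rightarrow> (real^3) set" where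
  "lattice3 b = {\<Sum>i=1..3. of_int (k i) *\<^sub>R b i | k :: nat \<Rightarrow> int. True}"

definition selling :: "(nat \<Rightarrow> real^3) \<Rightarrow> nat \<Rightarrow> nat \<Rightarrow> real" where
  "selling b i j = - (b i \<bullet> b j)"

definition gram_matrix :: "(real^'m)^'n \<Rightarrow> real^'n^'n" where
  "gram_matrix B = (\<chi> i j. B $ i \<bullet> B $ j)"

definition voronoi_cell :: "(real^3) set \<Rightarrow> (real^3) set" where
  "voronoi_cell L = {x. \<forall>v\<in>L. norm x \<le> norm (x - v)}"

text \<open>
  Area of a subset of a plane in space: the Lebesgue measure of its preimage under an isometric
  parametrization of such a plane. The value does not depend on the parametrization, since
  Lebesgue measure on the Euclidean plane is invariant under isometries, and a set contained
  in two distinct planes lies in a line and gets area 0.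
\<close>

definition planar_area :: "(real^3) set \<Rightarrow> real" where
  "planar_area S = (THE r. \<exists>g :: real^2 \<Rightarrow> real^3.
     (\<forall>x y. dist (g x) (g y) = dist x y) \<and> S \<subseteq> range g \<and> r = measure lebesgue (g -` S))"

text \<open>
  For convex polytopes only: their set of faces is finite, so the sum is a genuine one.
\<close>

definition surface_area :: "(real^3) set \<Rightarrow> real" where
  "surface_area P = (\<Sum>S | S face_of P \<and> aff_dim S = 2. planar_area S)"

end

theory Submission
  imports Defs
begin

text \<open>
  By Selling's formula, \<open>\<bar>\<Sum>k\<^sub>i b\<^sub>i\<bar>\<^sup>2 = \<Sum>\<rho>\<^sub>i\<^sub>j (k\<^sub>i - k\<^sub>j)\<^sup>2\<close>, and non-negativity of the \<open>\<rho>\<^sub>i\<^sub>j\<close> makes the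
  fourteen lattice vectors \<open>n = \<Sum>\<^sub>S b\<^sub>i\<close> (\<open>S\<close> a proper non-empty subset of the indices) the only ones needed
  to cut out the Voronoi cell. In suitable linear coordinates of its plane, the facet with normal \<open>n\<close> is
  a rectangle of area \<open>\<rho>\<^sub>i\<^sub>j \<rho>\<^sub>k\<^sub>l\<close> if \<open>S = {i, j}\<close>, and a hexagon of area
  \<open>\<rho>\<^sub>j\<^sub>k \<rho>\<^sub>j\<^sub>l + \<rho>\<^sub>j\<^sub>k \<rho>\<^sub>k\<^sub>l + \<rho>\<^sub>j\<^sub>l \<rho>\<^sub>k\<^sub>l\<close> if \<open>S\<close> or its complement is \<open>{i}\<close>; the Jacobian of these coordinates is
  \<open>\<bar>det B\<bar> / \<bar>n\<bar>\<close> with \<open>B\<close> the matrix of the basis. Degenerate facets are not counted in the surface area,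
  but their coordinate polygons have area zero, so the formula holds for them as well.
\<close>

section \<open>Areas of plane sets in linear coordinates\<close>

text \<open>Polarization: \<open>L x = g x - g 0\<close> preserves norms and distances, hence inner
  products, so the squared norms of its additivity and homogeneity defects expand to 0.\<close>

lemma isometry_linear_part:
  fixes g :: "'a::real_inner \<Rightarrow> 'b::real_inner"
  assumes iso: "\<forall>x y. dist (g x) (g y) = dist x y"
  obtains L where "linear L" "\<And>x. norm (L x) = norm x" "\<And>x. g x = g 0 + L x"
proof -
  define L where "L x = g x - g 0" for x
  have norm_L: "norm (L x) = norm x" for x
    using iso by (metis L_def dist_norm diff_zero)
  have "norm (L x - L y) = norm (x - y)" for x y
    using iso by (simp add: L_def dist_norm)
  then have "(L x - L y) \<bullet> (L x - L y) = (x - y) \<bullet> (x - y)" for x y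
    by (simp add: dot_square_norm)
  moreover have sq: "L x \<bullet> L x = x \<bullet> x" for x
    by (simp add: dot_square_norm norm_L)
  ultimately have inner_L: "L x \<bullet> L y = x \<bullet> y" for x y
    by (smt (verit, ccfv_SIG) inner_diff_left inner_diff_right inner_commute)
  have "linear L"
  proof (rule linearI)
    fix x y
    have "(L (x + y) - (L x + L y)) \<bullet> (L (x + y) - (L x + L y)) = 0"
      by (simp add: inner_diff inner_add inner_L algebra_simps)
    then show "L (x + y) = L x + L y" by simp
  next
    fix r x
    have "(L (r *\<^sub>R x) - r *\<^sub>R L x) \<bullet> (L (r *\<^sub>R x) - r *\<^sub>R L x) = 0"
      by (simp add: inner_diff inner_L algebra_simps)
    then show "L (r *\<^sub>R x) = r *\<^sub>R L x" by simp
  qed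
  with norm_L show thesis
    by (intro that[of L]) (auto simp: L_def)
qed

text \<open>The preimage is the image of the translate of \<open>T\<close> by \<open>- c\<close>
  under the inverse matrix, which scales measure by the reciprocal of the absolute
  determinant.\<close>

lemma measure_affine_preimage:
  fixes M :: "real^('n::{finite,wellorder})^('n::{finite,wellorder})"
  assumes "det M \<noteq> 0" and T: "T \<in> lmeasurable"
  shows "measure lebesgue {z. c + M *v z \<in> T} = measure lebesgue T / \<bar>det M\<bar>"
proof -
  obtain N where N: "M ** N = mat 1" "N ** M = mat 1"
    using assms(1) invertible_det_nz[of M] unfolding invertible_def by blast
  have "{z. c + M *v z \<in> T} = (*v) N ` (+) (- c) ` T"
  proof safe
    fix z assume "c + M *v z \<in> T"
    moreover have "z = N *v (- c + (c + M *v z))"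
      by (simp add: matrix_vector_mul_assoc N)
    ultimately show "z \<in> (*v) N ` (+) (- c) ` T" by blast
  qed (simp add: matrix_vector_mul_assoc N)
  moreover have "(+) (- c) ` T \<in> lmeasurable"
    using T by (rule measurable_translation)
  moreover have "\<bar>det N\<bar> * \<bar>det M\<bar> = 1"
    using N(2) by (metis abs_mult abs_one det_I det_mul)
  then have "\<bar>det N\<bar> = 1 / \<bar>det M\<bar>"
    using assms(1) by (simp add: field_simps)
  ultimately show ?thesis
    using measure_translation[of "- c" T] by (simp add: measure_linear_image del: add_uminus_conv_diff uminus_add_conv_diff)
qed

lemma solve_inner_3:
  fixes u w n :: "real^3"
  assumes "det (vector [u, w, n] :: real^3^3) \<noteq> 0"
  obtains x where "u \<bullet> x = p" "w \<bullet> x = q" "n \<bullet> x = r"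
proof -
  define M :: "real^3^3" where "M = vector [u, w, n]"
  obtain N where "M ** N = mat 1"
    using assms invertible_det_nz[of M] unfolding invertible_def M_def by blast
  then have "M *v (N *v vector [p, q, r]) = vector [p, q, r]"
    by (simp add: matrix_vector_mul_assoc)
  then have "(M $ i) \<bullet> (N *v vector [p, q, r]) = vector [p, q, r] $ i" for i
    by (metis matrix_vector_mul_component)
  from this[of 1] this[of 2] this[of 3] show thesis
    by (intro that) (simp_all add: M_def)
qed

text \<open>The images of the two axis vectors are orthonormal, and their cross product
  \<open>k\<close> is a unit normal of the plane, so \<open>n\<close> is a multiple of
  \<open>k\<close> of length \<open>norm n\<close>. By the identity for
  \<open>cross3 u w \<bullet> cross3 e e'\<close>, \<open>det M\<close> is the triple product of
  \<open>u\<close>, \<open>w\<close>, \<open>k\<close>. The triple product with \<open>n\<close>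
  instead of \<open>k\<close> differs by the factor \<open>k \<bullet> n\<close>.\<close>

lemma abs_det_plane_coordinates:
  fixes L :: "real^2 \<Rightarrow> real^3" and u w n :: "real^3"
  assumes L: "linear L" "\<And>z. norm (L z) = norm z" and n: "\<And>z. n \<bullet> L z = 0"
    and [simp]: "n \<noteq> 0"
  defines "M \<equiv> vector [vector [u \<bullet> L (axis 1 1), u \<bullet> L (axis 2 1)],
      vector [w \<bullet> L (axis 1 1), w \<bullet> L (axis 2 1)]] :: real^2^2"
  shows "\<bar>det M\<bar> = \<bar>det (vector [u, w, n] :: real^3^3)\<bar> / norm n"
    and "(vector [u \<bullet> L z, w \<bullet> L z] :: real^2) = M *v z"
proof -
  define e where "e = L (axis 1 1)"
  define e' where "e' = L (axis 2 1)"
  have ee: "e \<bullet> e = 1" "e' \<bullet> e' = 1"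
    by (simp_all add: e_def e'_def dot_square_norm L(2))
  have "norm (e + e') ^ 2 = norm (axis 1 1 + axis 2 1 :: real^2) ^ 2"
    unfolding e_def e'_def by (metis L linear_add)
  moreover have "norm (e + e') ^ 2 = 2 + 2 * (e \<bullet> e')"
    using ee by (simp add: power2_norm_eq_inner inner_add inner_commute[of e' e])
  moreover have "norm (axis 1 1 + axis 2 1 :: real^2) ^ 2 = 2"
    by (simp add: power2_norm_eq_inner inner_add inner_axis_axis)
  ultimately have ee': "e \<bullet> e' = 0" by simp
  define k where "k = cross3 e e'"
  have kk: "k \<bullet> k = 1"
    by (simp add: k_def dot_cross ee ee' inner_commute[of e' e])
  have "cross3 n k = 0"
    using n by (simp add: k_def Lagrange e_def e'_def)
  \<comment> \<open>Expanding this double cross product with \<open>k \<bullet> k = 1\<close>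
    expresses \<open>n\<close> through its component along \<open>k\<close>.\<close>
  then have "cross3 k (cross3 n k) = 0" by simp
  then have nk: "n = (k \<bullet> n) *\<^sub>R k"
    by (simp add: Lagrange kk)
  have "norm k = 1"
    by (metis kk norm_eq_1)
  then have norm_n: "norm n = \<bar>k \<bullet> n\<bar>"
    by (metis nk norm_scaleR mult.right_neutral)
  have "det M = cross3 u w \<bullet> k"
    by (simp add: M_def det_2 k_def dot_cross e_def e'_def)
  moreover have "det (vector [u, w, n] :: real^3^3) = n \<bullet> cross3 u w"
    by (simp add: cross3_simps)
  then have "det (vector [u, w, n] :: real^3^3) = (k \<bullet> n) * (k \<bullet> cross3 u w)"
    by (metis nk inner_scaleR_left)
  moreover have "k \<bullet> n \<noteq> 0"
    using \<open>n \<noteq> 0\<close> norm_n by auto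
  ultimately show "\<bar>det M\<bar> = \<bar>det (vector [u, w, n] :: real^3^3)\<bar> / norm n"
    using norm_n by (simp add: abs_mult inner_commute)
  have "L z = L (z $ 1 *\<^sub>R axis 1 1 + z $ 2 *\<^sub>R axis 2 1)"
    by (rule arg_cong[of _ _ L]) (simp add: vec_eq_iff forall_2 axis_def)
  then have Lz: "L z = z $ 1 *\<^sub>R e + z $ 2 *\<^sub>R e'"
    by (simp add: linear_add[OF L(1)] linear_scale[OF L(1)] e_def e'_def)
  show "(vector [u \<bullet> L z, w \<bullet> L z] :: real^2) = M *v z"
    unfolding Lz M_def e_def[symmetric] e'_def[symmetric]
    by (simp only: vec_eq_iff forall_2 matrix_vector_mult_def)
      (simp add: sum_2 inner_add_right mult.commute)
qed

text \<open>The definite description asks for existence and uniqueness. As \<open>S\<close> has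
  dimension 2, its affine hull is the whole plane \<open>H\<close>, and every admissible
  parametrization has range exactly \<open>H\<close>. In each of them the coordinates given by
  \<open>u\<close> and \<open>w\<close> are affine with the same absolute Jacobian, so the value is
  the same.\<close>

lemma planar_area_coordinates:
  fixes u w n :: "real^3" and T :: "(real^2) set"
  assumes det: "det (vector [u, w, n] :: real^3^3) \<noteq> 0" and T: "T \<in> lmeasurable"
    and S: "S = {x. n \<bullet> x = h \<and> vector [u \<bullet> x - \<alpha>, w \<bullet> x - \<beta>] \<in> T}" and dim: "aff_dim S = 2"
  shows "planar_area S = measure lebesgue T * norm n / \<bar>det (vector [u, w, n] :: real^3^3)\<bar>"
proof -
  have n0: "n \<noteq> 0"
    using det by (auto simp: det_3)
  define H where "H = {x. n \<bullet> x = h}"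
  have H: "affine H" "aff_dim H = 2"
    using n0 by (simp_all add: H_def affine_hyperplane)
  have SH: "S \<subseteq> H" by (auto simp: S H_def)
  have "S \<noteq> {}" using dim by auto
  have hull: "affine hull S = H"
    using SH H \<open>S \<noteq> {}\<close> dim by (intro affine_dim_equal) (auto simp: hull_minimal)
  let ?V = "measure lebesgue T * norm n / \<bar>det (vector [u, w, n] :: real^3^3)\<bar>"
  have val: "measure lebesgue (g -` S) = ?V"
    if iso: "\<forall>x y. dist (g x) (g y) = dist x y" and Sg: "S \<subseteq> range g" for g :: "real^2 \<Rightarrow> real^3"
  proof -
    obtain L where L: "linear L" "\<And>z. norm (L z) = norm z" and gL: "\<And>z. g z = g 0 + L z"
      using isometry_linear_part[OF iso] by blast
    have "inj L"
      using L by (metis linear_injective_0 norm_eq_zero)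
    have range_g: "range g = (+) (g 0) ` range L"
      unfolding image_image using gL by (rule image_cong[OF refl])
    then have "aff_dim (range g) = aff_dim (range L)"
      by (simp add: aff_dim_translation_eq)
    also have "\<dots> = 2"
      using L(1) \<open>inj L\<close> by (simp add: aff_dim_injective_linear_image)
    finally have "aff_dim (range g) = 2" .
    moreover have "affine (range g)"
      unfolding range_g using L(1)
      by (metis affine_translation subspace_imp_affine linear_subspace_image subspace_UNIV)
    moreover have "H \<subseteq> range g"
      using hull Sg \<open>affine (range g)\<close> by (metis hull_minimal)
    ultimately have "H = range g"
      using H \<open>S \<noteq> {}\<close> SH by (intro affine_dim_equal) auto
    then have gH: "n \<bullet> g z = h" for z
      by (auto simp: H_def)
    then have nL: "n \<bullet> L z = 0" for z
      using gL[of z] gH[of z] gH[of 0] by (metis add_cancel_right_right inner_add_right)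
    define M where "M = (vector [vector [u \<bullet> L (axis 1 1), u \<bullet> L (axis 2 1)],
      vector [w \<bullet> L (axis 1 1), w \<bullet> L (axis 2 1)]] :: real^2^2)"
    note M = abs_det_plane_coordinates[OF L nL n0, where u = u and w = w, folded M_def]
    define c where "c = (vector [u \<bullet> g 0 - \<alpha>, w \<bullet> g 0 - \<beta>] :: real^2)"
    have "vector [u \<bullet> g z - \<alpha>, w \<bullet> g z - \<beta>] = c + M *v z" for z
      unfolding M(2)[symmetric] by (subst (1 2) gL) (simp add: c_def vec_eq_iff forall_2 inner_add_right)
    then have "g -` S = {z. c + M *v z \<in> T}"
      by (simp add: S gH vimage_def)
    moreover have "det M \<noteq> 0"
      using M(1) det n0 by auto
    ultimately show ?thesis
      using T M(1) by (simp add: measure_affine_preimage)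
  qed
  show ?thesis unfolding planar_area_def
  proof (rule the_equality)
    \<comment> \<open>Existence: a linear isometry onto the plane through 0 orthogonal to
      \<open>n\<close>, translated to a point of \<open>S\<close>.\<close>
    obtain L :: "real^2 \<Rightarrow> real^3" where L: "linear L" "L \<in> UNIV \<rightarrow> {x. n \<bullet> x = 0}"
        "\<And>z. z \<in> UNIV \<Longrightarrow> norm (L z) = norm z"
      by (rule isometry_subset_subspace[of "UNIV :: (real^2) set" "{x. n \<bullet> x = 0}"])
        (use n0 in \<open>auto simp: subspace_hyperplane dim_hyperplane\<close>)
    then have L: "linear L" "\<And>z. norm (L z) = norm z" "\<And>z. n \<bullet> L z = 0"
      by auto
    have "inj L"
      using L(1,2) by (metis linear_injective_0 norm_eq_zero)
    have "range L = {x. n \<bullet> x = 0}"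
    proof (rule subspace_dim_equal)
      show "dim {x. n \<bullet> x = 0} \<le> dim (range L)"
        using n0 L(1) \<open>inj L\<close> by (simp add: dim_hyperplane dim_image_eq)
    qed (use L in \<open>auto simp: subspace_hyperplane linear_subspace_image\<close>)
    moreover obtain x0 where x0: "x0 \<in> S" using \<open>S \<noteq> {}\<close> by auto
    ultimately have "x - x0 \<in> range L" if "x \<in> S" for x
      using that SH by (auto simp: H_def inner_diff_right)
    then have Sg: "S \<subseteq> range (\<lambda>z. x0 + L z)"
      by (force simp: image_iff algebra_simps)
    have iso: "\<forall>x y. dist (x0 + L x) (x0 + L y) = dist x y"
      by (simp add: dist_norm L(2) flip: linear_diff[OF L(1)])
    show "\<exists>g::real^2 \<Rightarrow> real^3. (\<forall>x y. dist (g x) (g y) = dist x y) \<and> S \<subseteq> range g \<and>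
        ?V = measure lebesgue (g -` S)"
      using iso Sg val[OF iso Sg] by metis
  qed (use val in auto)
qed

section \<open>Areas of rectangles and hexagons\<close>

lemma measure_rectangle_cart2:
  assumes "0 \<le> r" "0 \<le> s"
  shows "{p :: real^2. \<bar>2 * p $ 1\<bar> \<le> r \<and> \<bar>2 * p $ 2\<bar> \<le> s} \<in> lmeasurable"
    and "measure lebesgue {p :: real^2. \<bar>2 * p $ 1\<bar> \<le> r \<and> \<bar>2 * p $ 2\<bar> \<le> s} = r * s"
proof -
  let ?l = "vector [- r/2, - s/2] :: real^2" and ?u = "vector [r/2, s/2] :: real^2"
  have eq: "{p :: real^2. \<bar>2 * p $ 1\<bar> \<le> r \<and> \<bar>2 * p $ 2\<bar> \<le> s} = cbox ?l ?u"
    by (auto simp: mem_box_cart forall_2 field_simps)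
  show "{p :: real^2. \<bar>2 * p $ 1\<bar> \<le> r \<and> \<bar>2 * p $ 2\<bar> \<le> s} \<in> lmeasurable"
    unfolding eq by simp
  \<comment> \<open>The content formula distinguishes the empty box; this one is non-empty even if
    \<open>r\<close> or \<open>s\<close> is 0.\<close>
  have "?l \<in> cbox ?l ?u"
    using assms by (simp add: mem_box_cart forall_2)
  then show "measure lebesgue {p :: real^2. \<bar>2 * p $ 1\<bar> \<le> r \<and> \<bar>2 * p $ 2\<bar> \<le> s} = r * s"
    unfolding eq by (subst measure_completion) (auto simp: content_cbox_if_cart UNIV_2)
qed

text \<open>The hexagon is the rectangle \<open>R\<close> with two opposite corner triangles cut
  off. These are right isosceles with legs \<open>d\<close>, so the area is
  \<open>(d + e) * (d + f) - d * d\<close>. Overlaps lie on lines and have measure 0.\<close>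

lemma measure_hexagon_cart2:
  assumes "0 \<le> d" "0 \<le> e" "0 \<le> f"
  defines "H \<equiv> {p :: real^2. \<bar>2 * p $ 1\<bar> \<le> d + e \<and> \<bar>2 * p $ 2\<bar> \<le> d + f \<and> \<bar>2 * (p $ 1 + p $ 2)\<bar> \<le> e + f}"
  shows "H \<in> lmeasurable" and "measure lebesgue H = d * e + d * f + e * f"
proof -
  define R where "R = {p :: real^2. \<bar>2 * p $ 1\<bar> \<le> d + e \<and> \<bar>2 * p $ 2\<bar> \<le> d + f}"
  define Q where "Q = {p :: real^2. \<bar>2 * p $ 1\<bar> \<le> d \<and> \<bar>2 * p $ 2\<bar> \<le> d}"
  have R: "R \<in> lmeasurable" "measure lebesgue R = (d + e) * (d + f)"
    using measure_rectangle_cart2[of "d + e" "d + f"] assms by (auto simp: R_def)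
  have Q: "Q \<in> lmeasurable" "measure lebesgue Q = d * d"
    using measure_rectangle_cart2[of d d] assms by (auto simp: Q_def)
  define n where "n = (vector [1, 1] :: real^2)"
  have n: "n \<bullet> p = p $ 1 + p $ 2" for p
    by (simp add: n_def inner_vec_def sum_2)
  have "n \<noteq> 0"
    by (simp add: n_def vec_eq_iff forall_2)
  then have line: "negligible {p :: real^2. p $ 1 + p $ 2 = r}" for r
    using negligible_hyperplane[of n r] by (simp add: n)
  have le: "closed {p :: real^2. p $ 1 + p $ 2 \<le> r}" and ge: "closed {p :: real^2. p $ 1 + p $ 2 \<ge> r}" for r
    using closed_halfspace_le[of n r] closed_halfspace_ge[of r n] by (simp_all add: n)
  have cut: "S \<inter> {p. p $ 1 + p $ 2 \<le> r} \<in> lmeasurable" "S \<inter> {p. p $ 1 + p $ 2 \<ge> r} \<in> lmeasurable"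
    if "S \<in> lmeasurable" for S :: "(real^2) set" and r
    using that le[of r] ge[of r] by (auto intro!: fmeasurable_Int_fmeasurable sets_completionI_sets borel_closed)
  define U where "U = R \<inter> {p. p $ 1 + p $ 2 \<ge> (e + f) / 2}"
  define L where "L = R \<inter> {p. p $ 1 + p $ 2 \<le> - (e + f) / 2}"
  have H_eq: "H = (R \<inter> {p. p $ 1 + p $ 2 \<le> (e + f) / 2}) \<inter> {p. p $ 1 + p $ 2 \<ge> - (e + f) / 2}"
    by (auto simp: H_def R_def abs_if field_simps)
  show H: "H \<in> lmeasurable"
    unfolding H_eq by (intro cut R)
  have UL: "U \<in> lmeasurable" "L \<in> lmeasurable"
    unfolding U_def L_def by (intro cut R)+
  have "measure lebesgue R = measure lebesgue H + measure lebesgue U + measure lebesgue L"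
  proof (rule measure_Un3_negligible[OF H UL])
    show "negligible (H \<inter> U)"
      by (rule negligible_subset[OF line[of "(e + f) / 2"]]) (auto simp: H_eq U_def)
    show "negligible (H \<inter> L)"
      by (rule negligible_subset[OF line[of "- (e + f) / 2"]]) (auto simp: H_eq L_def)
    \<comment> \<open>A common point forces \<open>e + f = 0\<close>, and then both cutting lines
      coincide.\<close>
    show "negligible (U \<inter> L)"
      by (rule negligible_subset[OF line[of "(e + f) / 2"]]) (use assms in \<open>auto simp: U_def L_def\<close>)
    show "H \<union> U \<union> L = R"
      by (auto simp: H_eq U_def L_def)
  qed
  moreover have "measure lebesgue Q = measure lebesgue U + measure lebesgue L"
  \<comment> \<open>The two corner triangles, translated, fill a square of side \<open>d\<close>.\<close>
  proof -
    \<comment> \<open>The translation by \<open>c\<close> takes the upper right corner of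
      \<open>R\<close> to that of \<open>Q\<close> and the cutting line of \<open>U\<close> to the
      diagonal \<open>p $ 1 + p $ 2 = 0\<close> of \<open>Q\<close>; the opposite translation does
      the same for \<open>L\<close> and the lower left corner.\<close>
    define c where "c = (vector [- e / 2, - f / 2] :: real^2)"
    have U': "(+) c ` U = Q \<inter> {p. p $ 1 + p $ 2 \<ge> 0}"
    proof -
      have "p \<in> (+) c ` U \<longleftrightarrow> p - c \<in> U" for p
        by (force simp: image_iff)
      then show ?thesis using assms by (auto simp: U_def R_def Q_def c_def abs_le_iff)
    qed
    have L': "(+) (- c) ` L = Q \<inter> {p. p $ 1 + p $ 2 \<le> 0}"
    proof -
      have "p \<in> (+) (- c) ` L \<longleftrightarrow> p + c \<in> L" for p
        by (force simp: image_iff)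
      then show ?thesis using assms by (auto simp: L_def R_def Q_def c_def abs_le_iff)
    qed
    have "Q = (+) c ` U \<union> (+) (- c) ` L"
      unfolding U' L' by auto
    moreover have "negligible ((+) c ` U \<inter> (+) (- c) ` L)"
      unfolding U' L' by (rule negligible_subset[OF line[of 0]]) auto
    ultimately show ?thesis
      using UL measure_Un3_negligible[of "(+) c ` U" "(+) (- c) ` L" "{}" Q]
      by (simp add: measurable_translation measure_translation del: add_uminus_conv_diff uminus_add_conv_diff)
  qed
  ultimately show "measure lebesgue H = d * e + d * f + e * f"
    using R(2) Q(2) by (simp add: algebra_simps)
qed

section \<open>Facets of a cell bounded by bisector planes\<close>

text \<open>Every point of \<open>T\<close> is the coordinate pair of some point of
  \<open>S\<close>, so \<open>T\<close> is contained in an affine image of \<open>S\<close>. As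
  \<open>S\<close> lies in a plane without having dimension 2, this image has dimension at most 1
  and lies in a line. This covers the degenerate facets, empty ones included.\<close>

lemma measure_coordinates_eq_0:
  fixes u w n :: "real^3" and T :: "(real^2) set"
  assumes det: "det (vector [u, w, n] :: real^3^3) \<noteq> 0"
    and S: "S = {x. n \<bullet> x = h \<and> vector [u \<bullet> x - \<alpha>, w \<bullet> x - \<beta>] \<in> T}" and dim: "aff_dim S \<noteq> 2"
  shows "measure lebesgue T = 0"
proof -
  have "n \<noteq> 0"
    using det by (auto simp: det_3)
  have "S \<subseteq> {x. n \<bullet> x = h}" by (auto simp: S)
  from aff_dim_subset[OF this] have "aff_dim S < 2"
    using dim \<open>n \<noteq> 0\<close> by simp
  define f where "f x = (vector [u \<bullet> x, w \<bullet> x] :: real^2)" for x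
  have "linear f"
    by (rule linearI) (simp_all add: f_def vec_eq_iff forall_2 inner_add_right)
  define c where "c = (vector [\<alpha>, \<beta>] :: real^2)"
  have "T \<subseteq> (+) (- c) ` f ` S"
  proof
    fix t assume "t \<in> T"
    obtain x where x: "u \<bullet> x = t $ 1 + \<alpha>" "w \<bullet> x = t $ 2 + \<beta>" "n \<bullet> x = h"
      using solve_inner_3[OF det] .
    have "vector [u \<bullet> x - \<alpha>, w \<bullet> x - \<beta>] = t" "t = - c + f x"
      by (simp_all add: vec_eq_iff forall_2 x f_def c_def)
    with x(3) \<open>t \<in> T\<close> have "x \<in> S" by (simp add: S)
    with \<open>t = - c + f x\<close> show "t \<in> (+) (- c) ` f ` S" by blast
  qed
  then have "aff_dim T \<le> aff_dim (f ` S)"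
    using aff_dim_subset aff_dim_translation_eq by metis
  also have "\<dots> < DIM(real^2)"
    using aff_dim_linear_image_le[OF \<open>linear f\<close>, of S] \<open>aff_dim S < 2\<close> by simp
  finally obtain k r where "k \<noteq> 0" "T \<subseteq> {p. k \<bullet> p = r}"
    by (rule aff_lowdim_subset_hyperplane)
  then have "negligible T"
    using negligible_hyperplane negligible_subset by blast
  then show ?thesis
    by (rule negligible_imp_measure0)
qed

section \<open>Faces of an intersection of finitely many half-spaces\<close>

lemma convex_halfspaces: "convex {x :: 'a::euclidean_space. \<forall>n\<in>N. n \<bullet> x \<le> h n}"
proof -
  have "{x :: 'a. \<forall>n\<in>N. n \<bullet> x \<le> h n} = (\<Inter>n\<in>N. {x. n \<bullet> x \<le> h n})"
    by auto
  then show ?thesis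
    by (simp only: convex_INT convex_halfspace_le)
qed

text \<open>At a relative interior point \<open>z\<close> of \<open>F\<close> some constraint is
  tight, since otherwise \<open>z\<close> would be interior to \<open>P\<close>, which no proper
  face meets. The face cut out by that constraint meets the relative interior of \<open>F\<close>
  and therefore contains \<open>F\<close>.\<close>

lemma facet_of_halfspaces_subset:
  fixes N :: "'a::euclidean_space set" and h :: "'a \<Rightarrow> real"
  assumes "finite N" and P: "P = {x. \<forall>n\<in>N. n \<bullet> x \<le> h n}"
    and F: "F face_of P" "F \<noteq> P" "F \<noteq> {}"
  shows "\<exists>n\<in>N. F \<subseteq> P \<inter> {x. n \<bullet> x = h n}"
proof -
  have "convex P"
    unfolding P by (rule convex_halfspaces)
  have "convex F"
    using F(1) by (rule face_of_imp_convex)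
  then obtain z where z: "z \<in> rel_interior F"
    using F(3) rel_interior_eq_empty by blast
  then have "z \<in> F" using rel_interior_subset by blast
  have "\<exists>n\<in>N. n \<bullet> z = h n"
  proof (rule ccontr)
    assume "\<not> ?thesis"
    then have "z \<in> (\<Inter>n\<in>N. {x. n \<bullet> x < h n})"
      using \<open>z \<in> F\<close> face_of_imp_subset[OF F(1)] by (force simp: P)
    moreover have "open (\<Inter>n\<in>N. {x. n \<bullet> x < h n})"
      using \<open>finite N\<close> by (intro open_INT ballI open_halfspace_lt)
    moreover have "(\<Inter>n\<in>N. {x. n \<bullet> x < h n}) \<subseteq> P"
      by (force simp: P)
    ultimately have "z \<in> interior P"
      by (meson interiorI)
    then show False
      using face_of_disjoint_interior[OF F(1,2)] \<open>z \<in> F\<close> by blast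
  qed
  then obtain n where n: "n \<in> N" "n \<bullet> z = h n" by blast
  have "P \<inter> {x. n \<bullet> x = h n} face_of P"
    using \<open>convex P\<close> n(1) by (intro face_of_Int_supporting_hyperplane_le) (auto simp: P)
  then have "F \<subseteq> P \<inter> {x. n \<bullet> x = h n}"
    using face_of_imp_subset[OF F(1)]
  proof (rule subset_of_face_of)
    have "z \<in> P \<inter> {x. n \<bullet> x = h n}"
      using n(2) \<open>z \<in> F\<close> face_of_imp_subset[OF F(1)] by blast
    then show "P \<inter> {x. n \<bullet> x = h n} \<inter> rel_interior F \<noteq> {}"
      using z by blast
  qed
  then show ?thesis using n(1) by blast
qed

text \<open>This turns the sum over faces into a sum over normals. Each two-dimensional face is some
  \<open>F n\<close>, and \<open>n\<close> can be recovered from it: the face spans its bisector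
  plane, whose point nearest to 0 is the half of \<open>n\<close>. Normals whose plane meets
  \<open>P\<close> in a smaller set contribute 0.\<close>

lemma surface_area_bisector_cell:
  fixes N :: "(real^3) set"
  assumes "finite N" "0 \<notin> N" and P: "P = {x. \<forall>n\<in>N. n \<bullet> x \<le> n \<bullet> n / 2}"
  defines "F \<equiv> \<lambda>n. P \<inter> {x. n \<bullet> x = n \<bullet> n / 2}"
  shows "surface_area P = (\<Sum>n\<in>N. if aff_dim (F n) = 2 then planar_area (F n) else 0)"
proof -
  have "convex P"
    unfolding P by (rule convex_halfspaces)
  have plane: "aff_dim {x. n \<bullet> x = r} = 2" if "n \<noteq> 0" for n :: "real^3" and r
    using that by simp
  have face: "F n face_of P" if "n \<in> N" for n
    unfolding F_def using \<open>convex P\<close> that by (intro face_of_Int_supporting_hyperplane_le) (auto simp: P)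
  \<comment> \<open>Hence \<open>P\<close> has dimension 3, and a face of dimension 2 is
    proper.\<close>
  have "0 \<in> interior P"
  proof (rule interiorI)
    show "open (\<Inter>n\<in>N. {x. n \<bullet> x < n \<bullet> n / 2})"
      using \<open>finite N\<close> by (intro open_INT ballI open_halfspace_lt)
    show "0 \<in> (\<Inter>n\<in>N. {x. n \<bullet> x < n \<bullet> n / 2})"
      using \<open>0 \<notin> N\<close> by auto
    show "(\<Inter>n\<in>N. {x. n \<bullet> x < n \<bullet> n / 2}) \<subseteq> P"
      unfolding P by (blast intro: less_imp_le)
  qed
  then have "aff_dim P = 3"
    using aff_dim_nonempty_interior[of P] by force
  have eq: "{S. S face_of P \<and> aff_dim S = 2} = F ` {n \<in> N. aff_dim (F n) = 2}"
  proof safe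
    fix S assume S: "S face_of P" "aff_dim S = 2"
    then have "S \<noteq> P" "S \<noteq> {}"
      using \<open>aff_dim P = 3\<close> by auto
    then obtain n where n: "n \<in> N" "S \<subseteq> F n"
      using facet_of_halfspaces_subset[OF \<open>finite N\<close> P S(1)] unfolding F_def by blast
    have "F n \<subseteq> {x. n \<bullet> x = n \<bullet> n / 2}" "n \<noteq> 0"
      using n(1) \<open>0 \<notin> N\<close> by (auto simp: F_def)
    then have "aff_dim (F n) \<le> 2"
      using aff_dim_subset plane by metis
    moreover have "S face_of F n"
      using S(1) n(2) face_of_imp_subset[OF face[OF n(1)]] by (rule face_of_subset)
    moreover have "convex (F n)"
      using face[OF n(1)] face_of_imp_convex \<open>convex P\<close> by blast
    \<comment> \<open>A proper face of a convex set has smaller dimension, but \<open>F n\<close>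
      has dimension at most 2.\<close>
    ultimately have "S = F n"
      using face_of_aff_dim_lt[of "F n" S] S(2) by linarith
    then show "S \<in> F ` {n \<in> N. aff_dim (F n) = 2}"
      using n(1) S(2) by blast
  qed (use face in auto)
  have "m = n" if mn: "m \<in> N" "n \<in> N" "aff_dim (F m) = 2" "F m = F n" for m n
  proof -
    have hull: "affine hull F k = {x. k \<bullet> x = k \<bullet> k / 2}" if "k \<in> N" "aff_dim (F k) = 2" for k
    proof (rule affine_dim_equal)
      show "affine hull F k \<subseteq> {x. k \<bullet> x = k \<bullet> k / 2}"
        unfolding F_def by (intro hull_minimal Int_lower2 affine_hyperplane)
      show "aff_dim (affine hull F k) = aff_dim {x. k \<bullet> x = k \<bullet> k / 2}"
        using that \<open>0 \<notin> N\<close> plane[of k] by (metis aff_dim_affine_hull)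
      show "affine hull F k \<noteq> {}" using that(2) by auto
    qed (rule affine_affine_hull affine_hyperplane)+
    have planes: "{x. m \<bullet> x = m \<bullet> m / 2} = {x. n \<bullet> x = n \<bullet> n / 2}"
      using hull[OF mn(1,3)] hull[OF mn(2)] mn(3,4) by metis
    \<comment> \<open>The midpoints \<open>m/2\<close> and \<open>n/2\<close> both lie in the common plane.\<close>
    have "m \<bullet> (n /\<^sub>R 2) = m \<bullet> m / 2 \<longleftrightarrow> n \<bullet> (n /\<^sub>R 2) = n \<bullet> n / 2"
      "m \<bullet> (m /\<^sub>R 2) = m \<bullet> m / 2 \<longleftrightarrow> n \<bullet> (m /\<^sub>R 2) = n \<bullet> n / 2"
      using planes by blast+
    then have "m \<bullet> n = m \<bullet> m" "n \<bullet> m = n \<bullet> n"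
      by simp_all
    then have "(m - n) \<bullet> (m - n) = 0"
      by (simp add: inner_diff)
    then show "m = n" by simp
  qed
  then have "inj_on F {n \<in> N. aff_dim (F n) = 2}"
    by (auto intro!: inj_onI)
  then have "surface_area P = (\<Sum>n\<in>{n \<in> N. aff_dim (F n) = 2}. planar_area (F n))"
    unfolding surface_area_def eq by (subst sum.reindex) auto
  then show ?thesis
    using \<open>finite N\<close> by (simp add: sum.inter_filter)
qed

section \<open>The Voronoi cell of an obtuse superbase\<close>

text \<open>For vectors of sum 0, complementary index sets have opposite partial sums. One set is
  taken from each complementary pair; the absolute value in \<open>selling_cell\<close> accounts for
  the other.\<close>

definition selling_normals :: "real^3 \<Rightarrow> real^3 \<Rightarrow> real^3 \<Rightarrow> real^3 \<Rightarrow> (real^3) set" where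
  "selling_normals v0 v1 v2 v3 = {v0, v1, v2, v3, v0 + v1, v0 + v2, v0 + v3}"

definition selling_cell :: "real^3 \<Rightarrow> real^3 \<Rightarrow> real^3 \<Rightarrow> real^3 \<Rightarrow> (real^3) set" where
  "selling_cell v0 v1 v2 v3 = {x. \<forall>n\<in>selling_normals v0 v1 v2 v3. \<bar>2 * (n \<bullet> x)\<bar> \<le> n \<bullet> n}"

text \<open>Renaming the vectors only reorders the normals and changes some signs. The first three
  renamings bring \<open>v1\<close>, \<open>v2\<close>, \<open>v3\<close> to the front, the last two
  bring \<open>v2\<close>, \<open>v3\<close> to the second place; so it suffices to study the facets
  of \<open>v0\<close> and \<open>v0 + v1\<close>.\<close>

lemma selling_cell_permute:
  assumes "v0 + v1 + v2 + v3 = 0"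
  shows "selling_cell v1 v0 v2 v3 = selling_cell v0 v1 v2 v3"
    and "selling_cell v2 v0 v1 v3 = selling_cell v0 v1 v2 v3"
    and "selling_cell v3 v0 v1 v2 = selling_cell v0 v1 v2 v3"
    and "selling_cell v0 v2 v1 v3 = selling_cell v0 v1 v2 v3"
    and "selling_cell v0 v3 v1 v2 = selling_cell v0 v1 v2 v3"
proof -
  have minus: "{x. \<bar>2 * (- n \<bullet> x)\<bar> \<le> - n \<bullet> - n} = {x. \<bar>2 * (n \<bullet> x)\<bar> \<le> n \<bullet> n}" for n :: "real^3"
    by simp
  have eqs: "v2 + v3 = - (v0 + v1)" "v1 + v3 = - (v0 + v2)" "v1 + v2 = - (v0 + v3)"
    "v3 + v2 = - (v0 + v1)" "v3 + v1 = - (v0 + v2)" "v2 + v1 = - (v0 + v3)"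
    "v1 + v0 = v0 + v1" "v2 + v0 = v0 + v2" "v3 + v0 = v0 + v3"
    using assms by (simp_all add: eq_neg_iff_add_eq_0 algebra_simps)
  have cell: "selling_cell v0 v1 v2 v3 = (\<Inter>n\<in>selling_normals v0 v1 v2 v3. {x. \<bar>2 * (n \<bullet> x)\<bar> \<le> n \<bullet> n})"
    for v0 v1 v2 v3
    by (auto simp: selling_cell_def)
  show "selling_cell v1 v0 v2 v3 = selling_cell v0 v1 v2 v3"
    "selling_cell v2 v0 v1 v3 = selling_cell v0 v1 v2 v3"
    "selling_cell v3 v0 v1 v2 = selling_cell v0 v1 v2 v3"
    "selling_cell v0 v2 v1 v3 = selling_cell v0 v1 v2 v3"
    "selling_cell v0 v3 v1 v2 = selling_cell v0 v1 v2 v3"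
    unfolding cell selling_normals_def eqs INT_insert minus by (simp_all only: Int_ac INT_empty)
qed

lemma selling_cell_uminus: "selling_cell (- v0) (- v1) (- v2) (- v3) = selling_cell v0 v1 v2 v3"
proof -
  have "selling_normals (- v0) (- v1) (- v2) (- v3) = uminus ` selling_normals v0 v1 v2 v3"
    by (simp add: selling_normals_def)
  then show ?thesis by (simp add: selling_cell_def)
qed

text \<open>Each vector is orthogonal to the zero sum, which expresses its square by the mixed
  products. The right-hand sides are cut weights: the numbers \<open>- (vi \<bullet> vj)\<close>
  summed over the pairs separated by the index set.\<close>

lemma selling_cut:
  fixes v0 v1 v2 v3 :: "'a::real_inner"
  assumes "v0 + v1 + v2 + v3 = 0"
  shows "v0 \<bullet> v0 = - (v0 \<bullet> v1) - v0 \<bullet> v2 - v0 \<bullet> v3"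
    and "v1 \<bullet> v1 = - (v0 \<bullet> v1) - v1 \<bullet> v2 - v1 \<bullet> v3"
    and "v2 \<bullet> v2 = - (v0 \<bullet> v2) - v1 \<bullet> v2 - v2 \<bullet> v3"
    and "v3 \<bullet> v3 = - (v0 \<bullet> v3) - v1 \<bullet> v3 - v2 \<bullet> v3"
    and "(v0 + v1) \<bullet> (v0 + v1) = - (v0 \<bullet> v2) - v0 \<bullet> v3 - v1 \<bullet> v2 - v1 \<bullet> v3"
    and "(v0 + v2) \<bullet> (v0 + v2) = - (v0 \<bullet> v1) - v0 \<bullet> v3 - v1 \<bullet> v2 - v2 \<bullet> v3"
    and "(v0 + v3) \<bullet> (v0 + v3) = - (v0 \<bullet> v1) - v0 \<bullet> v2 - v1 \<bullet> v3 - v2 \<bullet> v3"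
proof -
  have "v0 \<bullet> (v0 + v1 + v2 + v3) = 0" "v1 \<bullet> (v0 + v1 + v2 + v3) = 0"
    "v2 \<bullet> (v0 + v1 + v2 + v3) = 0" "v3 \<bullet> (v0 + v1 + v2 + v3) = 0"
    by (simp_all add: assms)
  note eqs = this[unfolded inner_add_right]
  show *: "v0 \<bullet> v0 = - (v0 \<bullet> v1) - v0 \<bullet> v2 - v0 \<bullet> v3"
    using eqs by linarith
  show **: "v1 \<bullet> v1 = - (v0 \<bullet> v1) - v1 \<bullet> v2 - v1 \<bullet> v3"
    using eqs by (simp add: inner_commute)
  show ***: "v2 \<bullet> v2 = - (v0 \<bullet> v2) - v1 \<bullet> v2 - v2 \<bullet> v3"
    using eqs by (simp add: inner_commute)
  show ****: "v3 \<bullet> v3 = - (v0 \<bullet> v3) - v1 \<bullet> v3 - v2 \<bullet> v3"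
    using eqs by (simp add: inner_commute)
  show "(v0 + v1) \<bullet> (v0 + v1) = - (v0 \<bullet> v2) - v0 \<bullet> v3 - v1 \<bullet> v2 - v1 \<bullet> v3"
    using * ** by (simp add: inner_add inner_commute[of v1 v0])
  show "(v0 + v2) \<bullet> (v0 + v2) = - (v0 \<bullet> v1) - v0 \<bullet> v3 - v1 \<bullet> v2 - v2 \<bullet> v3"
    using * *** by (simp add: inner_add inner_commute[of v2 v0])
  show "(v0 + v3) \<bullet> (v0 + v3) = - (v0 \<bullet> v1) - v0 \<bullet> v2 - v1 \<bullet> v3 - v2 \<bullet> v3"
    using * **** by (simp add: inner_add inner_commute[of v3 v0])
qed

lemma mem_selling_cell:
  assumes "v0 + v1 + v2 + v3 = 0"
    and "a = - (v0 \<bullet> v1)" "b = - (v0 \<bullet> v2)" "c = - (v0 \<bullet> v3)"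
    and "d = - (v1 \<bullet> v2)" "e = - (v1 \<bullet> v3)" "f = - (v2 \<bullet> v3)"
  shows "x \<in> selling_cell v0 v1 v2 v3 \<longleftrightarrow>
    \<bar>2 * (v0 \<bullet> x)\<bar> \<le> a + b + c \<and> \<bar>2 * (v1 \<bullet> x)\<bar> \<le> a + d + e \<and>
    \<bar>2 * (v2 \<bullet> x)\<bar> \<le> b + d + f \<and> \<bar>2 * (v3 \<bullet> x)\<bar> \<le> c + e + f \<and>
    \<bar>2 * (v0 \<bullet> x + v1 \<bullet> x)\<bar> \<le> b + c + d + e \<and>
    \<bar>2 * (v0 \<bullet> x + v2 \<bullet> x)\<bar> \<le> a + c + d + f \<and>
    \<bar>2 * (v0 \<bullet> x + v3 \<bullet> x)\<bar> \<le> a + b + e + f"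
  unfolding selling_cell_def selling_normals_def
  by (simp only: mem_Collect_eq ball_simps selling_cut[OF assms(1)])
    (simp add: assms inner_add_left)

section \<open>From the fourteen inequalities to all lattice vectors\<close>

lemma nat_layer_cake:
  fixes k :: nat
  assumes "k \<le> M"
  shows "real k = (\<Sum>t<M. of_bool (t < k))"
proof -
  have "(\<Sum>t<M. of_bool (t < k)) = real (card ({..<M} \<inter> {t. t < k}))"
    by (simp add: of_bool_def sum.If_cases)
  also have "{..<M} \<inter> {t. t < k} = {..<k}" using assms by auto
  finally show ?thesis by simp
qed

text \<open>The indicators of \<open>t < k\<close> and \<open>t < l\<close> are ordered the same way
  for all \<open>t\<close>, so their differences add up without cancellation.\<close>

lemma nat_layer_cake_diff:
  fixes k l :: nat
  assumes "k \<le> M" "l \<le> M"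
  shows "\<bar>real k - real l\<bar> = (\<Sum>t<M. \<bar>of_bool (t < k) - of_bool (t < l)\<bar>)"
proof -
  have le: "\<bar>real k - real l\<bar> = (\<Sum>t<M. \<bar>of_bool (t < k) - of_bool (t < l)\<bar>)"
    if "l \<le> k" "k \<le> M" "l \<le> M" for k l :: nat
  proof -
    have "(\<Sum>t<M. \<bar>of_bool (t < k) - of_bool (t < l) :: real\<bar>) = (\<Sum>t<M. of_bool (t < k) - of_bool (t < l))"
      by (rule sum.cong) (use that in auto)
    also have "\<dots> = real k - real l"
      by (simp only: sum_subtractf nat_layer_cake[OF that(2)] nat_layer_cake[OF that(3)])
    finally show ?thesis using that(1) by simp
  qed
  show ?thesis
  proof (cases "l \<le> k")
    case False
    then show ?thesis
      using le[of k l] assms by (simp add: abs_minus_commute)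
  qed (rule le, use assms in auto)
qed

text \<open>
  The layer-cake decomposition of the integers \<open>k\<^sub>i\<close> reduces the claim to coefficients in \<open>{0, 1}\<close>,
  for which it says that the fourteen inequalities hold.
\<close>

lemma cut_inequalities_nat:
  fixes y0 y1 y2 y3 a b c d e f :: real and k0 k1 k2 k3 :: nat
  assumes "y0 + y1 + y2 + y3 = 0"
    and "\<bar>2 * y0\<bar> \<le> a + b + c" "\<bar>2 * y1\<bar> \<le> a + d + e" "\<bar>2 * y2\<bar> \<le> b + d + f" "\<bar>2 * y3\<bar> \<le> c + e + f"
    and "\<bar>2 * (y0 + y1)\<bar> \<le> b + c + d + e" "\<bar>2 * (y0 + y2)\<bar> \<le> a + c + d + f"
      "\<bar>2 * (y0 + y3)\<bar> \<le> a + b + e + f"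
  shows "2 * (k0 * y0 + k1 * y1 + k2 * y2 + k3 * y3) \<le>
    a * \<bar>real k0 - k1\<bar> + b * \<bar>real k0 - k2\<bar> + c * \<bar>real k0 - k3\<bar> +
    d * \<bar>real k1 - k2\<bar> + e * \<bar>real k1 - k3\<bar> + f * \<bar>real k2 - k3\<bar>"
proof -
  define M where "M = k0 + k1 + k2 + k3"
  have M: "k0 \<le> M" "k1 \<le> M" "k2 \<le> M" "k3 \<le> M"
    by (simp_all add: M_def)
  note bounds = assms(2-8)[unfolded distrib_left, THEN abs_le_D1] assms(2-8)[unfolded distrib_left, THEN abs_le_D2]
  let ?\<chi> = "\<lambda>k t. of_bool (t < k) :: real"
  have "2 * (k0 * y0 + k1 * y1 + k2 * y2 + k3 * y3) =
    (\<Sum>t<M. 2 * (?\<chi> k0 t * y0 + ?\<chi> k1 t * y1 + ?\<chi> k2 t * y2 + ?\<chi> k3 t * y3))"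
    by (simp only: M[THEN nat_layer_cake] sum_distrib_left sum_distrib_right sum.distrib distrib_left)
  also have "\<dots> \<le> (\<Sum>t<M.
    a * \<bar>?\<chi> k0 t - ?\<chi> k1 t\<bar> + b * \<bar>?\<chi> k0 t - ?\<chi> k2 t\<bar> + c * \<bar>?\<chi> k0 t - ?\<chi> k3 t\<bar> +
    d * \<bar>?\<chi> k1 t - ?\<chi> k2 t\<bar> + e * \<bar>?\<chi> k1 t - ?\<chi> k3 t\<bar> + f * \<bar>?\<chi> k2 t - ?\<chi> k3 t\<bar>)"
  proof (rule sum_mono)
    fix t
    show "2 * (?\<chi> k0 t * y0 + ?\<chi> k1 t * y1 + ?\<chi> k2 t * y2 + ?\<chi> k3 t * y3) \<le>
      a * \<bar>?\<chi> k0 t - ?\<chi> k1 t\<bar> + b * \<bar>?\<chi> k0 t - ?\<chi> k2 t\<bar> + c * \<bar>?\<chi> k0 t - ?\<chi> k3 t\<bar> +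
      d * \<bar>?\<chi> k1 t - ?\<chi> k2 t\<bar> + e * \<bar>?\<chi> k1 t - ?\<chi> k3 t\<bar> + f * \<bar>?\<chi> k2 t - ?\<chi> k3 t\<bar>"
      \<comment> \<open>Each case is the set of indices whose coefficient exceeds \<open>t\<close>.
        For a proper non-empty set the claim is one of the bounds, up to passing to the complement;
        for the empty and the full set both sides are 0.\<close>
      by (cases "t < k0"; cases "t < k1"; cases "t < k2"; cases "t < k3"; simp)
        (use assms(1) bounds in linarith)+
  qed
  also have "\<dots> = a * \<bar>real k0 - k1\<bar> + b * \<bar>real k0 - k2\<bar> + c * \<bar>real k0 - k3\<bar> +
    d * \<bar>real k1 - k2\<bar> + e * \<bar>real k1 - k3\<bar> + f * \<bar>real k2 - k3\<bar>"
    by (simp only: nat_layer_cake_diff[OF M(1) M(2)] nat_layer_cake_diff[OF M(1) M(3)] nat_layer_cake_diff[OF M(1) M(4)]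
      nat_layer_cake_diff[OF M(2) M(3)] nat_layer_cake_diff[OF M(2) M(4)] nat_layer_cake_diff[OF M(3) M(4)]
      sum_distrib_left sum.distrib)
  finally show ?thesis .
qed

text \<open>Expand the square and replace the diagonal products by mixed ones: the coefficient of
  each mixed product becomes minus the square of a difference.\<close>

lemma selling_formula:
  fixes v0 v1 v2 v3 :: "'a::real_inner"
  assumes "v0 + v1 + v2 + v3 = 0"
    and "w = k0 *\<^sub>R v0 + k1 *\<^sub>R v1 + k2 *\<^sub>R v2 + k3 *\<^sub>R v3"
  shows "w \<bullet> w = - (v0 \<bullet> v1) * (k0 - k1)\<^sup>2 - (v0 \<bullet> v2) * (k0 - k2)\<^sup>2 - (v0 \<bullet> v3) * (k0 - k3)\<^sup>2
    - (v1 \<bullet> v2) * (k1 - k2)\<^sup>2 - (v1 \<bullet> v3) * (k1 - k3)\<^sup>2 - (v2 \<bullet> v3) * (k2 - k3)\<^sup>2"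
proof -
  have "w \<bullet> w = k0\<^sup>2 * (v0 \<bullet> v0) + k1\<^sup>2 * (v1 \<bullet> v1) + k2\<^sup>2 * (v2 \<bullet> v2) + k3\<^sup>2 * (v3 \<bullet> v3)
    + 2 * (k0 * k1 * (v0 \<bullet> v1) + k0 * k2 * (v0 \<bullet> v2) + k0 * k3 * (v0 \<bullet> v3)
    + k1 * k2 * (v1 \<bullet> v2) + k1 * k3 * (v1 \<bullet> v3) + k2 * k3 * (v2 \<bullet> v3))"
    unfolding assms(2)
    by (simp add: inner_add inner_commute[of v1 v0] inner_commute[of v2 v0] inner_commute[of v3 v0]
      inner_commute[of v2 v1] inner_commute[of v3 v1] inner_commute[of v3 v2] power2_eq_square algebra_simps)
  then show ?thesis
    unfolding selling_cut[OF assms(1)] by (simp add: power2_eq_square algebra_simps)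
qed

text \<open>Integrality enters here: a non-zero integer has absolute value at least 1.\<close>

lemma abs_diff_nat_le_square: "\<bar>real k - real l\<bar> \<le> (real k - real l)\<^sup>2"
proof -
  have "\<bar>int k - int l\<bar> \<le> (int k - int l)\<^sup>2"
    by (metis abs_ge_zero int_one_le_iff_zero_less mult_le_cancel_left1 not_less power2_abs power2_eq_square order.order_iff_strict zero_less_abs_iff)
  then have "real_of_int \<bar>int k - int l\<bar> \<le> real_of_int ((int k - int l)\<^sup>2)"
    by (simp only: of_int_le_iff)
  then show ?thesis by simp
qed

lemma mem_voronoi_cell_iff:
  "x \<in> voronoi_cell L \<longleftrightarrow> (\<forall>v\<in>L. 2 * (v \<bullet> x) \<le> v \<bullet> v)"
proof -
  have "norm x \<le> norm (x - v) \<longleftrightarrow> 2 * (v \<bullet> x) \<le> v \<bullet> v" for v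
    unfolding norm_le by (simp add: inner_diff inner_commute[of x v])
  then show ?thesis by (simp add: voronoi_cell_def)
qed

text \<open>One inclusion holds because the normals and their negatives are lattice vectors. For the
  other, \<open>2 * (v \<bullet> x)\<close> is at most the weighted sum of the absolute coefficient
  differences, by the cut inequalities. As the weights are non-negative and the coefficients
  integers, this is at most the weighted sum of squares, which is
  \<open>v \<bullet> v\<close>.\<close>

lemma voronoi_cell_eq_selling_cell:
  assumes sum: "v0 + v1 + v2 + v3 = 0"
    and obtuse: "v0 \<bullet> v1 \<le> 0" "v0 \<bullet> v2 \<le> 0" "v0 \<bullet> v3 \<le> 0" "v1 \<bullet> v2 \<le> 0" "v1 \<bullet> v3 \<le> 0" "v2 \<bullet> v3 \<le> 0"
  shows "voronoi_cell (range (\<lambda>(i, j, k). of_int i *\<^sub>R v1 + of_int j *\<^sub>R v2 + of_int k *\<^sub>R v3))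
    = selling_cell v0 v1 v2 v3" (is "voronoi_cell (range ?g) = _")
proof safe
  fix x assume x: "x \<in> voronoi_cell (range ?g)"
  have v0: "v0 = - v1 - v2 - v3"
    using sum by (simp add: algebra_simps eq_neg_iff_add_eq_0)
  have "n \<in> range ?g \<and> - n \<in> range ?g" if n: "n \<in> selling_normals v0 v1 v2 v3" for n
  proof -
    have "v0 = ?g (-1, -1, -1)" "v1 = ?g (1, 0, 0)" "v2 = ?g (0, 1, 0)" "v3 = ?g (0, 0, 1)"
      "v0 + v1 = ?g (0, -1, -1)" "v0 + v2 = ?g (-1, 0, -1)" "v0 + v3 = ?g (-1, -1, 0)"
      by (simp_all add: v0 algebra_simps)
    then have "n \<in> range ?g"
      using n unfolding selling_normals_def by blast
    moreover then obtain i j k where "n = ?g (i, j, k)"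
      by auto
    then have "- n = ?g (- i, - j, - k)"
      by simp
    ultimately show ?thesis by blast
  qed
  then have "2 * (n \<bullet> x) \<le> n \<bullet> n" "2 * (- n \<bullet> x) \<le> - n \<bullet> - n"
    if "n \<in> selling_normals v0 v1 v2 v3" for n
    using x that unfolding mem_voronoi_cell_iff by blast+
  then show "x \<in> selling_cell v0 v1 v2 v3"
    by (simp add: selling_cell_def abs_le_iff)
next
  fix x assume x: "x \<in> selling_cell v0 v1 v2 v3"
  have y: "v0 \<bullet> x + v1 \<bullet> x + v2 \<bullet> x + v3 \<bullet> x = 0"
    using sum by (metis inner_add_left inner_zero_left)
  have "2 * (v \<bullet> x) \<le> v \<bullet> v" if v_in: "v \<in> range ?g" for v
  proof -
    obtain i j k where v: "v = of_int i *\<^sub>R v1 + of_int j *\<^sub>R v2 + of_int k *\<^sub>R v3"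
      using v_in by auto
    \<comment> \<open>Adding \<open>m\<close> times the zero vector \<open>v0 + v1 + v2 + v3\<close>
      makes all four coefficients natural numbers and leaves their differences unchanged;
      \<open>v0\<close> had coefficient 0 before.\<close>
    define m where "m = \<bar>i\<bar> + \<bar>j\<bar> + \<bar>k\<bar>"
    define k0 k1 k2 k3 where "k0 = nat m" "k1 = nat (m + i)" "k2 = nat (m + j)" "k3 = nat (m + k)"
    have k: "real k0 = m" "real k1 = m + i" "real k2 = m + j" "real k3 = m + k"
      by (simp_all add: k0_k1_k2_k3_def m_def)
    have "v = v + m *\<^sub>R (v0 + v1 + v2 + v3)"
      by (simp add: sum)
    then have v': "v = k0 *\<^sub>R v0 + k1 *\<^sub>R v1 + k2 *\<^sub>R v2 + k3 *\<^sub>R v3"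
      by (simp add: k v algebra_simps)
    have "2 * (v \<bullet> x) = 2 * (k0 * (v0 \<bullet> x) + k1 * (v1 \<bullet> x) + k2 * (v2 \<bullet> x) + k3 * (v3 \<bullet> x))"
      by (simp add: v' inner_add_left)
    also have "\<dots> \<le> - (v0 \<bullet> v1) * \<bar>real k0 - k1\<bar> + - (v0 \<bullet> v2) * \<bar>real k0 - k2\<bar> + - (v0 \<bullet> v3) * \<bar>real k0 - k3\<bar> +
        - (v1 \<bullet> v2) * \<bar>real k1 - k2\<bar> + - (v1 \<bullet> v3) * \<bar>real k1 - k3\<bar> + - (v2 \<bullet> v3) * \<bar>real k2 - k3\<bar>"
      using x unfolding mem_selling_cell[OF sum refl refl refl refl refl refl]
      by (intro cut_inequalities_nat y) auto
    also have "\<dots> \<le> - (v0 \<bullet> v1) * (real k0 - k1)\<^sup>2 + - (v0 \<bullet> v2) * (real k0 - k2)\<^sup>2 + - (v0 \<bullet> v3) * (real k0 - k3)\<^sup>2 +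
        - (v1 \<bullet> v2) * (real k1 - k2)\<^sup>2 + - (v1 \<bullet> v3) * (real k1 - k3)\<^sup>2 + - (v2 \<bullet> v3) * (real k2 - k3)\<^sup>2"
      using obtuse by (intro add_mono mult_left_mono abs_diff_nat_le_square) auto
    also have "\<dots> = v \<bullet> v"
      using selling_formula[OF sum v'] by simp
    finally show ?thesis .
  qed
  then show "x \<in> voronoi_cell (range ?g)"
    unfolding mem_voronoi_cell_iff by blast
qed

section \<open>The fourteen facets\<close>

definition obtuse_superbase :: "real^3 \<Rightarrow> real^3 \<Rightarrow> real^3 \<Rightarrow> real^3 \<Rightarrow> bool" where
  "obtuse_superbase v0 v1 v2 v3 \<longleftrightarrow> v0 + v1 + v2 + v3 = 0 \<and> v0 \<bullet> v1 \<le> 0 \<and> v0 \<bullet> v2 \<le> 0 \<and> v0 \<bullet> v3 \<le> 0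
    \<and> v1 \<bullet> v2 \<le> 0 \<and> v1 \<bullet> v3 \<le> 0 \<and> v2 \<bullet> v3 \<le> 0"

lemma obtuse_superbase_permute:
  assumes "obtuse_superbase v0 v1 v2 v3"
  shows "obtuse_superbase v1 v0 v2 v3" "obtuse_superbase v2 v0 v1 v3" "obtuse_superbase v3 v0 v1 v2"
    "obtuse_superbase v0 v2 v1 v3" "obtuse_superbase v0 v3 v1 v2"
    "obtuse_superbase (- v0) (- v1) (- v2) (- v3)"
proof -
  have sum: "v0 + v1 + v2 + v3 = 0"
    using assms by (simp add: obtuse_superbase_def)
  then have "v1 + v0 + v2 + v3 = 0" "v2 + v0 + v1 + v3 = 0" "v3 + v0 + v1 + v2 = 0"
    "v0 + v2 + v1 + v3 = 0" "v0 + v3 + v1 + v2 = 0"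
    by (simp_all only: add_ac)
  moreover have "- v0 + - v1 + - v2 + - v3 = 0"
    using arg_cong[OF sum, of uminus] by simp
  ultimately show "obtuse_superbase v1 v0 v2 v3" "obtuse_superbase v2 v0 v1 v3" "obtuse_superbase v3 v0 v1 v2"
    "obtuse_superbase v0 v2 v1 v3" "obtuse_superbase v0 v3 v1 v2"
    "obtuse_superbase (- v0) (- v1) (- v2) (- v3)"
    using assms unfolding obtuse_superbase_def by (simp_all only: inner_commute inner_minus_left inner_minus_right minus_minus simp_thms)
qed

text \<open>Each listed triple arises from \<open>v1\<close>, \<open>v2\<close>, \<open>v3\<close>
  by an integer matrix of determinant 1 or -1.\<close>

lemma abs_det_superbase:
  fixes v0 v1 v2 v3 :: "real^3"
  assumes "v0 + v1 + v2 + v3 = 0"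
  defines "D \<equiv> \<bar>det (vector [v1, v2, v3] :: real^3^3)\<bar>"
  shows "\<bar>det (vector [v0, v2, v3] :: real^3^3)\<bar> = D" "\<bar>det (vector [v0, v1, v3] :: real^3^3)\<bar> = D"
    "\<bar>det (vector [v0, v1, v2] :: real^3^3)\<bar> = D" "\<bar>det (vector [v2, v1, v3] :: real^3^3)\<bar> = D"
    "\<bar>det (vector [v3, v1, v2] :: real^3^3)\<bar> = D" "\<bar>det (vector [- v1, - v2, - v3] :: real^3^3)\<bar> = D"
    "\<bar>det (vector [v1, v2, v0] :: real^3^3)\<bar> = D" "\<bar>det (vector [v0, v2, v0 + v1] :: real^3^3)\<bar> = D"
proof -
  have v0: "v0 = - v1 - v2 - v3"
    using assms(1) by (simp add: algebra_simps eq_neg_iff_add_eq_0)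
  let ?d = "det (vector [v1, v2, v3] :: real^3^3)"
  have "det (vector [v0, v2, v3] :: real^3^3) = - ?d" "det (vector [v0, v1, v3] :: real^3^3) = ?d"
    "det (vector [v0, v1, v2] :: real^3^3) = - ?d" "det (vector [v2, v1, v3] :: real^3^3) = - ?d"
    "det (vector [v3, v1, v2] :: real^3^3) = ?d" "det (vector [- v1, - v2, - v3] :: real^3^3) = - ?d"
    "det (vector [v1, v2, v0] :: real^3^3) = - ?d" "det (vector [v0, v2, v0 + v1] :: real^3^3) = ?d"
    by (simp_all add: v0 det_3 algebra_simps)
  then show "\<bar>det (vector [v0, v2, v3] :: real^3^3)\<bar> = D" "\<bar>det (vector [v0, v1, v3] :: real^3^3)\<bar> = D"
    "\<bar>det (vector [v0, v1, v2] :: real^3^3)\<bar> = D" "\<bar>det (vector [v2, v1, v3] :: real^3^3)\<bar> = D"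
    "\<bar>det (vector [v3, v1, v2] :: real^3^3)\<bar> = D" "\<bar>det (vector [- v1, - v2, - v3] :: real^3^3)\<bar> = D"
    "\<bar>det (vector [v1, v2, v0] :: real^3^3)\<bar> = D" "\<bar>det (vector [v0, v2, v0 + v1] :: real^3^3)\<bar> = D"
    by (simp_all add: D_def)
qed

text \<open>The default 0 agrees with \<open>surface_area\<close>, where only faces of dimension 2
  count. It also keeps the area formula valid for degenerate facets, whose coordinate polygon has
  measure 0.\<close>

definition facet_area :: "(real^3) set \<Rightarrow> real^3 \<Rightarrow> real" where
  "facet_area P n = (let F = P \<inter> {x. n \<bullet> x = n \<bullet> n / 2} in if aff_dim F = 2 then planar_area F else 0)"

lemma facet_area_coordinates:
  fixes u w n :: "real^3" and T :: "(real^2) set"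
  assumes "det (vector [u, w, n] :: real^3^3) \<noteq> 0" "T \<in> lmeasurable"
    and "\<And>x. n \<bullet> x = n \<bullet> n / 2 \<Longrightarrow> x \<in> P \<longleftrightarrow> vector [u \<bullet> x - \<alpha>, w \<bullet> x - \<beta>] \<in> T"
  shows "facet_area P n = measure lebesgue T * norm n / \<bar>det (vector [u, w, n] :: real^3^3)\<bar>"
proof -
  have F: "P \<inter> {x. n \<bullet> x = n \<bullet> n / 2} = {x. n \<bullet> x = n \<bullet> n / 2 \<and> vector [u \<bullet> x - \<alpha>, w \<bullet> x - \<beta>] \<in> T}"
    using assms(3) by blast
  show ?thesis
    using planar_area_coordinates[OF assms(1,2) F] measure_coordinates_eq_0[OF assms(1) F]
    by (auto simp: facet_area_def Let_def)
qed

text \<open>With \<open>yi\<close> standing for \<open>vi \<bullet> x\<close>, the bounds on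
  \<open>yi\<close> and \<open>y0 + yi\<close> combine on the facet plane into one strip for each
  \<open>i\<close> from 1 to 3. The sum condition rewrites the third strip in the coordinates of the
  first two, and three strips bound the hexagon.\<close>

lemma hexagonal_facet_ineqs:
  fixes y0 y1 y2 y3 a b c d e f :: real
  assumes "y0 + y1 + y2 + y3 = 0" "2 * y0 = a + b + c"
    and "0 \<le> a" "0 \<le> b" "0 \<le> c" "0 \<le> d" "0 \<le> e" "0 \<le> f"
  shows "(\<bar>2 * y0\<bar> \<le> a + b + c \<and> \<bar>2 * y1\<bar> \<le> a + d + e \<and> \<bar>2 * y2\<bar> \<le> b + d + f \<and> \<bar>2 * y3\<bar> \<le> c + e + f \<and>
      \<bar>2 * (y0 + y1)\<bar> \<le> b + c + d + e \<and> \<bar>2 * (y0 + y2)\<bar> \<le> a + c + d + f \<and> \<bar>2 * (y0 + y3)\<bar> \<le> a + b + e + f)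
    \<longleftrightarrow> (\<bar>2 * (y1 + a / 2)\<bar> \<le> d + e \<and> \<bar>2 * (y2 + b / 2)\<bar> \<le> d + f \<and>
      \<bar>2 * ((y1 + a / 2) + (y2 + b / 2))\<bar> \<le> e + f)"
proof -
  \<comment> \<open>Here \<open>s\<close> is the parameter joining 0 to the index of
    \<open>y\<close>, \<open>t\<close> the rest of the cut of 0, and \<open>r\<close> the sum of the
    other two parameters at that index. The lower bound on \<open>y\<close> and the upper bound on
    \<open>y0 + y\<close> are the sharp ones.\<close>
  have pair: "\<bar>2 * y\<bar> \<le> s + r \<and> \<bar>2 * (y0 + y)\<bar> \<le> t + r \<longleftrightarrow> \<bar>2 * (y + s / 2)\<bar> \<le> r"
    if "2 * y0 = s + t" "0 \<le> s" "0 \<le> t" for y s t r :: real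
    unfolding abs_le_iff distrib_left right_diff_distrib using that by auto
  have "\<bar>2 * y0\<bar> \<le> a + b + c"
    using assms by simp
  moreover have "\<bar>2 * y1\<bar> \<le> a + d + e \<and> \<bar>2 * (y0 + y1)\<bar> \<le> b + c + d + e \<longleftrightarrow> \<bar>2 * (y1 + a / 2)\<bar> \<le> d + e"
    using pair[of a "b + c" y1 "d + e"] assms(2-5) by (simp add: add.assoc)
  moreover have "\<bar>2 * y2\<bar> \<le> b + d + f \<and> \<bar>2 * (y0 + y2)\<bar> \<le> a + c + d + f \<longleftrightarrow> \<bar>2 * (y2 + b / 2)\<bar> \<le> d + f"
    using pair[of b "a + c" y2 "d + f"] assms(2-5) by (simp add: add_ac)
  moreover have "\<bar>2 * y3\<bar> \<le> c + e + f \<and> \<bar>2 * (y0 + y3)\<bar> \<le> a + b + e + f \<longleftrightarrow> \<bar>2 * (y3 + c / 2)\<bar> \<le> e + f"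
    using pair[of c "a + b" y3 "e + f"] assms(2-5) by (simp add: add_ac)
  moreover have "2 * (y3 + c / 2) = - (2 * ((y1 + a / 2) + (y2 + b / 2)))"
    using assms(1,2) by simp
  then have "\<bar>2 * (y3 + c / 2)\<bar> = \<bar>2 * ((y1 + a / 2) + (y2 + b / 2))\<bar>"
    by (simp only: abs_minus_cancel)
  ultimately show ?thesis by metis
qed

text \<open>On this plane the bounds on \<open>y0\<close> and \<open>y1\<close> merge into a strip
  of width \<open>a\<close>, those on \<open>y2\<close> and \<open>y3\<close> into one of width
  \<open>f\<close>. The strips imply the remaining bounds.\<close>

lemma rectangular_facet_ineqs:
  fixes y0 y1 y2 y3 a b c d e f :: real
  assumes "y0 + y1 + y2 + y3 = 0" "2 * (y0 + y1) = b + c + d + e"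
    and "0 \<le> a" "0 \<le> b" "0 \<le> c" "0 \<le> d" "0 \<le> e" "0 \<le> f"
  shows "(\<bar>2 * y0\<bar> \<le> a + b + c \<and> \<bar>2 * y1\<bar> \<le> a + d + e \<and> \<bar>2 * y2\<bar> \<le> b + d + f \<and> \<bar>2 * y3\<bar> \<le> c + e + f \<and>
      \<bar>2 * (y0 + y1)\<bar> \<le> b + c + d + e \<and> \<bar>2 * (y0 + y2)\<bar> \<le> a + c + d + f \<and> \<bar>2 * (y0 + y3)\<bar> \<le> a + b + e + f)
    \<longleftrightarrow> (\<bar>2 * (y0 - (b + c) / 2)\<bar> \<le> a \<and> \<bar>2 * (y2 + (b + d) / 2)\<bar> \<le> f)"
proof -
  have pair: "\<bar>2 * x\<bar> \<le> r + s \<and> \<bar>2 * y\<bar> \<le> r + t \<longleftrightarrow> \<bar>2 * (x - s / 2)\<bar> \<le> r"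
    if "2 * (x + y) = s + t" "0 \<le> s" "0 \<le> t" for x y r s t :: real
    unfolding abs_le_iff distrib_left right_diff_distrib using that by auto
  have "\<bar>2 * (y0 + y1)\<bar> \<le> b + c + d + e"
    using assms by simp
  moreover have "\<bar>2 * y0\<bar> \<le> a + b + c \<and> \<bar>2 * y1\<bar> \<le> a + d + e \<longleftrightarrow> \<bar>2 * (y0 - (b + c) / 2)\<bar> \<le> a"
    using pair[of y0 y1 "b + c" "d + e" a] assms(2-7) by (simp add: add.assoc)
  moreover have "\<bar>2 * y2\<bar> \<le> b + d + f \<and> \<bar>2 * y3\<bar> \<le> c + e + f \<longleftrightarrow> \<bar>2 * (y2 + (b + d) / 2)\<bar> \<le> f"
  proof -
    have "2 * (- y2 + - y3) = (b + d) + (c + e)"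
      using assms(1,2) by simp
    then have "\<bar>2 * - y2\<bar> \<le> f + (b + d) \<and> \<bar>2 * - y3\<bar> \<le> f + (c + e) \<longleftrightarrow> \<bar>2 * (- y2 - (b + d) / 2)\<bar> \<le> f"
      by (rule pair) (use assms in simp_all)
    moreover have "2 * (- y2 - (b + d) / 2) = - (2 * (y2 + (b + d) / 2))"
      by simp
    ultimately show ?thesis
      by (simp only: mult_minus_right abs_minus_cancel add_ac)
  qed
  \<comment> \<open>Up to constants, \<open>2 * (y0 + y2)\<close> and \<open>2 * (y0 + y3)\<close>
    are the sum and the difference of the two strip coordinates, so the triangle inequality
    suffices.\<close>
  moreover have "\<bar>2 * (y0 + y2)\<bar> \<le> a + c + d + f \<and> \<bar>2 * (y0 + y3)\<bar> \<le> a + b + e + f"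
    if "\<bar>2 * (y0 - (b + c) / 2)\<bar> \<le> a" "\<bar>2 * (y2 + (b + d) / 2)\<bar> \<le> f"
  proof -
    have "\<bar>p + q\<bar> \<le> a + f" "\<bar>p - q\<bar> \<le> a + f" if "\<bar>p\<bar> \<le> a" "\<bar>q\<bar> \<le> f" for p q
      using that by linarith+
    note this[OF that]
    moreover have "2 * (y0 - (b + c) / 2) + 2 * (y2 + (b + d) / 2) = 2 * (y0 + y2) - c + d"
      "2 * (y0 - (b + c) / 2) - 2 * (y2 + (b + d) / 2) = 2 * (y0 + y3) - b + e"
      using assms(1,2) by (simp_all add: field_simps)
    ultimately have "\<bar>2 * (y0 + y2) - c + d\<bar> \<le> a + f" "\<bar>2 * (y0 + y3) - b + e\<bar> \<le> a + f"
      by simp_all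
    then show ?thesis
      using assms(4-7) unfolding abs_le_iff by auto
  qed
  ultimately show ?thesis by blast
qed

text \<open>The plane coordinates are the inner products with \<open>v1\<close>, \<open>v2\<close>
  for the hexagon and with \<open>v0\<close>, \<open>v2\<close> for the rectangle, shifted to centre
  the polygon at 0. Together with the normal, each pair has the absolute determinant of the basis;
  the length of the normal is the root of its cut weight.\<close>

lemma facet_areas:
  assumes base: "obtuse_superbase v0 v1 v2 v3"
    and det: "det (vector [v1, v2, v3] :: real^3^3) \<noteq> 0"
    and par: "a = - (v0 \<bullet> v1)" "b = - (v0 \<bullet> v2)" "c = - (v0 \<bullet> v3)"
      "d = - (v1 \<bullet> v2)" "e = - (v1 \<bullet> v3)" "f = - (v2 \<bullet> v3)"
  shows hexagonal_facet_area: "facet_area (selling_cell v0 v1 v2 v3) v0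
      = sqrt (a + b + c) * (d * e + d * f + e * f) / \<bar>det (vector [v1, v2, v3] :: real^3^3)\<bar>"
    and rectangular_facet_area: "facet_area (selling_cell v0 v1 v2 v3) (v0 + v1)
      = a * f * sqrt (b + c + d + e) / \<bar>det (vector [v1, v2, v3] :: real^3^3)\<bar>"
proof -
  have sum: "v0 + v1 + v2 + v3 = 0"
    and nonneg: "0 \<le> a" "0 \<le> b" "0 \<le> c" "0 \<le> d" "0 \<le> e" "0 \<le> f"
    using base by (auto simp: obtuse_superbase_def par)
  have y: "v0 \<bullet> x + v1 \<bullet> x + v2 \<bullet> x + v3 \<bullet> x = 0" for x
    using sum by (metis inner_add_left inner_zero_left)
  have sq: "v0 \<bullet> v0 = a + b + c" "(v0 + v1) \<bullet> (v0 + v1) = b + c + d + e"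
    by (simp_all only: selling_cut[OF sum] par)
  note mem = mem_selling_cell[OF sum par]
  define H where "H = {p :: real^2. \<bar>2 * p $ 1\<bar> \<le> d + e \<and> \<bar>2 * p $ 2\<bar> \<le> d + f \<and> \<bar>2 * (p $ 1 + p $ 2)\<bar> \<le> e + f}"
  have H: "H \<in> lmeasurable" "measure lebesgue H = d * e + d * f + e * f"
    using measure_hexagon_cart2[OF nonneg(4-6)] by (simp_all add: H_def)
  have "facet_area (selling_cell v0 v1 v2 v3) v0
      = measure lebesgue H * norm v0 / \<bar>det (vector [v1, v2, v0] :: real^3^3)\<bar>"
  proof (rule facet_area_coordinates)
    show "det (vector [v1, v2, v0] :: real^3^3) \<noteq> 0"
      using det abs_det_superbase(7)[OF sum] by simp
    fix x assume "v0 \<bullet> x = v0 \<bullet> v0 / 2"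
    then have "2 * (v0 \<bullet> x) = a + b + c"
      by (simp add: sq)
    from hexagonal_facet_ineqs[OF y this nonneg]
    show "x \<in> selling_cell v0 v1 v2 v3 \<longleftrightarrow> vector [v1 \<bullet> x - (- a / 2), v2 \<bullet> x - (- b / 2)] \<in> H"
      by (simp only: mem) (simp add: H_def)
  qed (rule H)
  then show "facet_area (selling_cell v0 v1 v2 v3) v0
      = sqrt (a + b + c) * (d * e + d * f + e * f) / \<bar>det (vector [v1, v2, v3] :: real^3^3)\<bar>"
    by (simp add: H(2) abs_det_superbase(7)[OF sum] norm_eq_sqrt_inner sq mult.commute)
  define R where "R = {p :: real^2. \<bar>2 * p $ 1\<bar> \<le> a \<and> \<bar>2 * p $ 2\<bar> \<le> f}"
  have R: "R \<in> lmeasurable" "measure lebesgue R = a * f"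
    using measure_rectangle_cart2[OF nonneg(1,6)] by (simp_all add: R_def)
  have "facet_area (selling_cell v0 v1 v2 v3) (v0 + v1)
      = measure lebesgue R * norm (v0 + v1) / \<bar>det (vector [v0, v2, v0 + v1] :: real^3^3)\<bar>"
  proof (rule facet_area_coordinates)
    show "det (vector [v0, v2, v0 + v1] :: real^3^3) \<noteq> 0"
      using det abs_det_superbase(8)[OF sum] by simp
    fix x assume "(v0 + v1) \<bullet> x = (v0 + v1) \<bullet> (v0 + v1) / 2"
    then have "2 * (v0 \<bullet> x + v1 \<bullet> x) = b + c + d + e"
      by (simp only: sq inner_add_left[of v0 v1 x]) simp
    from rectangular_facet_ineqs[OF y this nonneg]
    show "x \<in> selling_cell v0 v1 v2 v3 \<longleftrightarrow> vector [v0 \<bullet> x - (b + c) / 2, v2 \<bullet> x - (- ((b + d) / 2))] \<in> R"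
      by (simp only: mem) (simp add: R_def)
  qed (rule R)
  then show "facet_area (selling_cell v0 v1 v2 v3) (v0 + v1)
      = a * f * sqrt (b + c + d + e) / \<bar>det (vector [v1, v2, v3] :: real^3^3)\<bar>"
    by (simp only: R(2) abs_det_superbase(8)[OF sum] norm_eq_sqrt_inner sq)
qed

section \<open>Summation over the facets\<close>

lemma sum_facet_areas:
  assumes base: "obtuse_superbase v0 v1 v2 v3"
    and det: "det (vector [v1, v2, v3] :: real^3^3) \<noteq> 0"
    and par: "a = - (v0 \<bullet> v1)" "b = - (v0 \<bullet> v2)" "c = - (v0 \<bullet> v3)"
      "d = - (v1 \<bullet> v2)" "e = - (v1 \<bullet> v3)" "f = - (v2 \<bullet> v3)"
  shows "(\<Sum>n\<leftarrow>[v0, v1, v2, v3, v0 + v1, v0 + v2, v0 + v3]. facet_area (selling_cell v0 v1 v2 v3) n) =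
    (a * f * sqrt (b + c + d + e) + b * e * sqrt (a + c + d + f) + c * d * sqrt (a + b + e + f)
      + sqrt (a + b + c) * (d*e + d*f + e*f) + sqrt (a + d + e) * (b*c + b*f + c*f)
      + sqrt (b + d + f) * (a*c + a*e + c*e) + sqrt (c + e + f) * (a*b + a*d + b*d))
    / \<bar>det (vector [v1, v2, v3] :: real^3^3)\<bar>"
proof -
  have sum: "v0 + v1 + v2 + v3 = 0"
    using base by (simp add: obtuse_superbase_def)
  let ?P = "selling_cell v0 v1 v2 v3" and ?D = "\<bar>det (vector [v1, v2, v3] :: real^3^3)\<bar>"
  note D = abs_det_superbase[OF sum]
  have nz: "det (vector [v0, v2, v3] :: real^3^3) \<noteq> 0" "det (vector [v0, v1, v3] :: real^3^3) \<noteq> 0"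
    "det (vector [v0, v1, v2] :: real^3^3) \<noteq> 0" "det (vector [v2, v1, v3] :: real^3^3) \<noteq> 0"
    "det (vector [v3, v1, v2] :: real^3^3) \<noteq> 0"
    using det D by auto
  note perm = obtuse_superbase_permute[OF base]
  have par': "a = - (v1 \<bullet> v0)" "b = - (v2 \<bullet> v0)" "c = - (v3 \<bullet> v0)"
    "d = - (v2 \<bullet> v1)" "e = - (v3 \<bullet> v1)" "f = - (v3 \<bullet> v2)"
    using par by (simp_all add: inner_commute)
  have "facet_area ?P v0 = sqrt (a + b + c) * (d*e + d*f + e*f) / ?D"
    by (rule hexagonal_facet_area[OF base det par])
  \<comment> \<open>Exchanging \<open>v0\<close> and \<open>v1\<close> fixes \<open>a\<close> and
    \<open>f\<close> and exchanges \<open>b\<close> with \<open>d\<close> and \<open>c\<close> with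
    \<open>e\<close>. The other facets are obtained by similar renamings of the parameters.\<close>
  moreover have "facet_area ?P v1 = sqrt (a + d + e) * (b*c + b*f + c*f) / ?D"
    using hexagonal_facet_area[OF perm(1) nz(1) par'(1) par(4,5,2,3,6)]
    by (simp only: selling_cell_permute[OF sum] D)
  moreover have "facet_area ?P v2 = sqrt (b + d + f) * (a*c + a*e + c*e) / ?D"
    using hexagonal_facet_area[OF perm(2) nz(2) par'(2,4) par(6,1,3,5)]
    by (simp only: selling_cell_permute[OF sum] D)
  moreover have "facet_area ?P v3 = sqrt (c + e + f) * (a*b + a*d + b*d) / ?D"
    using hexagonal_facet_area[OF perm(3) nz(3) par'(3,5,6) par(1,2,4)]
    by (simp only: selling_cell_permute[OF sum] D)
  moreover have "facet_area ?P (v0 + v1) = a * f * sqrt (b + c + d + e) / ?D"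
    by (rule rectangular_facet_area[OF base det par])
  moreover have "facet_area ?P (v0 + v2) = b * e * sqrt (a + c + d + f) / ?D"
    using rectangular_facet_area[OF perm(4) nz(4) par(2,1,3) par'(4) par(6,5)]
    by (simp only: selling_cell_permute[OF sum] D)
  moreover have "facet_area ?P (v0 + v3) = c * d * sqrt (a + b + e + f) / ?D"
    using rectangular_facet_area[OF perm(5) nz(5) par(3,1,2) par'(5,6) par(4)]
    by (simp only: selling_cell_permute[OF sum] D)
  ultimately show ?thesis
    by (simp add: add_divide_distrib)
qed

lemma surface_area_selling_cell:
  assumes base: "obtuse_superbase v0 v1 v2 v3"
    and det: "det (vector [v1, v2, v3] :: real^3^3) \<noteq> 0"
    and par: "a = - (v0 \<bullet> v1)" "b = - (v0 \<bullet> v2)" "c = - (v0 \<bullet> v3)"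
      "d = - (v1 \<bullet> v2)" "e = - (v1 \<bullet> v3)" "f = - (v2 \<bullet> v3)"
  shows "surface_area (selling_cell v0 v1 v2 v3) =
    2 * (a * f * sqrt (b + c + d + e) + b * e * sqrt (a + c + d + f) + c * d * sqrt (a + b + e + f)
      + sqrt (a + b + c) * (d*e + d*f + e*f) + sqrt (a + d + e) * (b*c + b*f + c*f)
      + sqrt (b + d + f) * (a*c + a*e + c*e) + sqrt (c + e + f) * (a*b + a*d + b*d))
    / \<bar>det (vector [v1, v2, v3] :: real^3^3)\<bar>"
proof -
  let ?P = "selling_cell v0 v1 v2 v3"
  define ns where "ns = [v0, v1, v2, v3, v0 + v1, v0 + v2, v0 + v3]"
  define ms where "ms = [- v0, - v1, - v2, - v3, - v0 + - v1, - v0 + - v2, - v0 + - v3]"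
  have sum: "v0 + v1 + v2 + v3 = 0"
    using base by (simp add: obtuse_superbase_def)
  \<comment> \<open>The fourteen normals take distinct values at a suitable point.\<close>
  obtain z where z: "v1 \<bullet> z = 1" "v2 \<bullet> z = 2" "v3 \<bullet> z = 4"
    using solve_inner_3[OF det] .
  have "v0 \<bullet> z + v1 \<bullet> z + v2 \<bullet> z + v3 \<bullet> z = 0"
    using sum by (metis inner_add_left inner_zero_left)
  then have z0: "v0 \<bullet> z = -7" using z by simp
  \<comment> \<open>With the values 1, 2, 4 and -7, the normals in \<open>ns\<close> and
    \<open>ms\<close> take each of the values 1 to 7 and -1 to -7 exactly once.\<close>
  have "distinct (map (\<lambda>n. n \<bullet> z) (ns @ ms))"
    by (simp add: ns_def ms_def inner_add_left inner_diff_left z z0)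
  then have dist: "distinct (ns @ ms)"
    by (metis distinct_map)
  have "n \<bullet> z \<noteq> 0" if "n \<in> set (ns @ ms)" for n
    using that by (auto simp: ns_def ms_def inner_add_left inner_diff_left z z0)
  then have "0 \<notin> set (ns @ ms)"
    by force
  have "set ms = uminus ` set ns" "set ns = selling_normals v0 v1 v2 v3"
    by (simp_all add: ns_def ms_def selling_normals_def)
  then have P: "?P = {x. \<forall>n\<in>set (ns @ ms). n \<bullet> x \<le> n \<bullet> n / 2}"
    unfolding selling_cell_def by (auto simp: abs_le_iff ball_Un)
  have "surface_area ?P = (\<Sum>n\<in>set (ns @ ms). facet_area ?P n)"
    using surface_area_bisector_cell[OF finite_set \<open>0 \<notin> set (ns @ ms)\<close> P]
    by (simp only: facet_area_def Let_def)
  also have "\<dots> = (\<Sum>n\<leftarrow>ns @ ms. facet_area ?P n)"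
    using dist by (rule sum_list_distinct_conv_sum_set[symmetric])
  also have "\<dots> = (\<Sum>n\<leftarrow>ns. facet_area ?P n) + (\<Sum>n\<leftarrow>ms. facet_area ?P n)"
    by (simp only: map_append sum_list_append)
  \<comment> \<open>The negated vectors form an obtuse superbase with the same parameters and the
    same cell, and \<open>ms\<close> lists its normals. This is the origin of the factor 2.\<close>
  also have "(\<Sum>n\<leftarrow>ms. facet_area ?P n) = (\<Sum>n\<leftarrow>ns. facet_area ?P n)"
  proof -
    have det': "det (vector [- v1, - v2, - v3] :: real^3^3) \<noteq> 0"
      using det abs_det_superbase(6)[OF sum] by simp
    have "a = - (- v0 \<bullet> - v1)" "b = - (- v0 \<bullet> - v2)" "c = - (- v0 \<bullet> - v3)"
      "d = - (- v1 \<bullet> - v2)" "e = - (- v1 \<bullet> - v3)" "f = - (- v2 \<bullet> - v3)"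
      by (simp_all add: par)
    from sum_facet_areas[OF obtuse_superbase_permute(6)[OF base] det' this]
    show ?thesis
      by (simp only: ns_def ms_def sum_facet_areas[OF base det par] selling_cell_uminus abs_det_superbase(6)[OF sum])
  qed
  finally show ?thesis
    unfolding ns_def sum_facet_areas[OF base det par] by (simp only: mult_2 add_divide_distrib)
qed

section \<open>The isoperimetric quotient in Selling parameters\<close>

theorem mainTheorem1:
  fixes v :: "nat \<Rightarrow> real^3"
    and \<Lambda> :: "(real^3) set"
    and A :: "real^3^3"
    and a b c d e f A\<^sub>T F :: real
  assumes basis: "is_basis3 v"
    and v0: "v 0 = - v 1 - v 2 - v 3"
    and lattice: "\<Lambda> = lattice3 v"
    and nonneg: "\<And>i j. i < j \<Longrightarrow> j \<le> 3 \<Longrightarrow> 0 \<le> selling v i j"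
    and params: "a = selling v 0 1" "b = selling v 0 2" "c = selling v 0 3"
                "d = selling v 1 2" "e = selling v 1 3" "f = selling v 2 3"
    and gram: "A = gram_matrix (vector [v 1, v 2, v 3])"
    and area: "A\<^sub>T = surface_area (voronoi_cell \<Lambda>)"
    and quotient: "F = A\<^sub>T / det A powr (1/3)"
  shows "F = 2 / det A powr (5/6) *
           (a * f * sqrt (b + c + d + e) + b * e * sqrt (a + c + d + f)
            + c * d * sqrt (a + b + e + f)
            + sqrt (a + b + c) * (d*e + d*f + e*f) + sqrt (a + d + e) * (b*c + b*f + c*f)
            + sqrt (b + d + f) * (a*c + a*e + c*e) + sqrt (c + e + f) * (a*b + a*d + b*d))
    \<and> det A = a*b*c + a*b*e + a*b*f + a*c*d + a*c*f + a*d*e + a*d*f + a*e*f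
            + b*c*d + b*c*e + b*d*e + b*d*f + b*e*f + c*d*e + c*d*f + c*e*f"
proof -
  have sum: "v 0 + v 1 + v 2 + v 3 = 0"
    by (simp add: v0)
  have base: "obtuse_superbase (v 0) (v 1) (v 2) (v 3)"
    using sum nonneg[of 0 1] nonneg[of 0 2] nonneg[of 0 3] nonneg[of 1 2] nonneg[of 1 3] nonneg[of 2 3]
    by (simp add: obtuse_superbase_def selling_def)
  define B where "B = (vector [v 1, v 2, v 3] :: real^3^3)"
  note par = params[unfolded selling_def]
  have three: "{1..3} = {1, 2, 3 :: nat}" by auto
  have "rows B = (\<lambda>i. B $ i) ` UNIV"
    by (auto simp: rows_def row_def)
  also have "\<dots> = v ` {1..3}"
    unfolding three UNIV_3 by (simp add: B_def)
  finally have "rows B = v ` {1..3}" .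
  then have "span (rows B) = UNIV"
    using basis by (simp add: is_basis3_def)
  then have det: "det B \<noteq> 0"
    using matrix_left_invertible_span_rows[of B] invertible_left_inverse invertible_det_nz by blast
  have "A = B ** transpose B"
    by (simp add: gram gram_matrix_def B_def vec_eq_iff matrix_matrix_mult_def transpose_def inner_vec_def)
  then have det_A: "det A = (det B)\<^sup>2"
    by (simp add: det_mul power2_eq_square)
  have "\<Lambda> = range (\<lambda>(i, j, k). of_int i *\<^sub>R v 1 + of_int j *\<^sub>R v 2 + of_int k *\<^sub>R v 3)" (is "_ = range ?g")
  proof (intro equalityI subsetI)
    fix x assume "x \<in> \<Lambda>"
    then obtain k :: "nat \<Rightarrow> int" where "x = ?g (k 1, k 2, k 3)"
      unfolding lattice lattice3_def three by (auto simp: add.assoc)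
    then show "x \<in> range ?g" by blast
  next
    fix x assume "x \<in> range ?g"
    then obtain i j l where x: "x = ?g (i, j, l)" by (auto simp: image_iff)
    \<comment> \<open>All indices get the value \<open>l\<close> first; those at 1 and 2 are then
      overwritten, so that index 3 keeps \<open>l\<close>.\<close>
    define k where "k = (\<lambda>_ :: nat. l)(1 := i, 2 := j)"
    have "x = (\<Sum>i=1..3. of_int (k i) *\<^sub>R v i)"
      unfolding x three by (simp add: k_def add.assoc)
    then show "x \<in> \<Lambda>"
      unfolding lattice lattice3_def by blast
  qed
  then have "voronoi_cell \<Lambda> = selling_cell (v 0) (v 1) (v 2) (v 3)"
    using voronoi_cell_eq_selling_cell[OF sum] base by (simp add: obtuse_superbase_def)
  then have A\<^sub>T: "A\<^sub>T = 2 * (a * f * sqrt (b + c + d + e) + b * e * sqrt (a + c + d + f)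
            + c * d * sqrt (a + b + e + f)
            + sqrt (a + b + c) * (d*e + d*f + e*f) + sqrt (a + d + e) * (b*c + b*f + c*f)
            + sqrt (b + d + f) * (a*c + a*e + c*e) + sqrt (c + e + f) * (a*b + a*d + b*d)) / \<bar>det B\<bar>"
    (is "_ = 2 * ?S / _")
    unfolding area B_def
    using surface_area_selling_cell[OF base det[unfolded B_def] par] by simp
  have "det A > 0"
    using det by (simp add: det_A)
  \<comment> \<open>The denominator of the area contributes the exponent 1/2 and the normalization
    1/3, together 5/6.\<close>
  have "\<bar>det B\<bar> = det A powr (1/2)"
    by (simp add: det_A powr_half_sqrt)
  then have "F = 2 * ?S / (det A powr (1/2) * det A powr (1/3))"
    by (simp add: quotient A\<^sub>T)
  also have "det A powr (1/2) * det A powr (1/3) = det A powr (5/6)"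
    by (simp flip: powr_add)
  finally have "F = 2 / det A powr (5/6) * ?S"
    by simp
  moreover have "det A = a*b*c + a*b*e + a*b*f + a*c*d + a*c*f + a*d*e + a*d*f + a*e*f
            + b*c*d + b*c*e + b*d*e + b*d*f + b*e*f + c*d*e + c*d*f + c*e*f"
  proof -
    \<comment> \<open>In these parameters \<open>A\<close> is the Laplacian of the weighted complete
      graph on four vertices with the row and column of vertex 0 removed; the 16 monomials of its
      determinant correspond to the spanning trees.\<close>
    have "v 1 \<bullet> v 1 = a + d + e" "v 2 \<bullet> v 2 = b + d + f" "v 3 \<bullet> v 3 = c + e + f"
      "v 1 \<bullet> v 2 = - d" "v 1 \<bullet> v 3 = - e" "v 2 \<bullet> v 3 = - f"
      "v 2 \<bullet> v 1 = - d" "v 3 \<bullet> v 1 = - e" "v 3 \<bullet> v 2 = - f"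
      using selling_cut(2-4)[OF sum] by (simp_all add: par inner_commute)
    then show ?thesis
      by (simp add: gram gram_matrix_def det_3 algebra_simps)
  qed
  ultimately show ?thesis by blast
qed

end
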